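(* There exists an absolute constant $c>0$ such that for all sufficiently large primes $q$, $$\mathrm{Nikodym}(2,q)\ \le\ q^2-q^{1+c}.$$
   Context: For $x\in\mathbb{F}_q^d$ and $v\in\mathbb{F}_q^d\setminus\{0\}$ write $\ell(x,v)^*=\{x+tv: t\in\mathbb{F}_q\}\setminus\{x\}$. A set $N\subset\mathbb{F}_q^d$ is a Nikodym set if for every $x\in\mathbb{F}_q^d$ there exists $v\in\mathbb{F}_q^d\setminus\{0\}$ such that $\ell(x,v)^*\subset N$. $\mathrm{Nikodym}(d,q)$ denotes the size of the smallest Nikodym set in $\mathbb{F}_q^d$. *)

theory Defs
  imports "HOL-Number_Theory.Residues" "HOL-Library.FuncSet" Complex_Main
begin

text \<open>
  Vectors of length \<open>d\<close> over a ring \<open>R\<close> are the extensional functions on \<open>{..<d}\<close> with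
  values in the carrier, so that equality of vectors is equality of their \<open>d\<close> coordinates.
\<close>

definition vecs :: "('a, 'm) ring_scheme \<Rightarrow> nat \<Rightarrow> (nat \<Rightarrow> 'a) set" where
  "vecs R d = {..<d} \<rightarrow>\<^sub>E carrier R"

definition zero_vec :: "('a, 'm) ring_scheme \<Rightarrow> nat \<Rightarrow> nat \<Rightarrow> 'a" where
  "zero_vec R d = (\<lambda>i\<in>{..<d}. \<zero>\<^bsub>R\<^esub>)"

definition line_point ::
    "('a, 'm) ring_scheme \<Rightarrow> nat \<Rightarrow> (nat \<Rightarrow> 'a) \<Rightarrow> (nat \<Rightarrow> 'a) \<Rightarrow> 'a \<Rightarrow> nat \<Rightarrow> 'a" where
  "line_point R d x v t = (\<lambda>i\<in>{..<d}. x i \<oplus>\<^bsub>R\<^esub> (t \<otimes>\<^bsub>R\<^esub> v i))"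

definition punctured_line ::
    "('a, 'm) ring_scheme \<Rightarrow> nat \<Rightarrow> (nat \<Rightarrow> 'a) \<Rightarrow> (nat \<Rightarrow> 'a) \<Rightarrow> (nat \<Rightarrow> 'a) set" where
  "punctured_line R d x v = {line_point R d x v t | t. t \<in> carrier R} - {x}"

definition nikodym_set ::
    "('a, 'm) ring_scheme \<Rightarrow> nat \<Rightarrow> (nat \<Rightarrow> 'a) set \<Rightarrow> bool" where
  "nikodym_set R d N \<longleftrightarrow> N \<subseteq> vecs R d \<and>
     (\<forall>x\<in>vecs R d. \<exists>v\<in>vecs R d - {zero_vec R d}. punctured_line R d x v \<subseteq> N)"

text \<open>
  Meaningful for a finite field \<open>R\<close> and \<open>d \<ge> 1\<close>: then the whole space is a Nikodym set and every
  Nikodym set is finite, so the minimum exists.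
\<close>

definition nikodym_number :: "('a, 'm) ring_scheme \<Rightarrow> nat \<Rightarrow> nat" where
  "nikodym_number R d = (LEAST n. \<exists>N. nikodym_set R d N \<and> card N = n)"

lemma finite_vecs: "finite (carrier R) \<Longrightarrow> finite (vecs R d)"
  by (simp add: vecs_def finite_PiE)

lemma nikodym_set_vecs:
  assumes "field R" and "0 < d"
  shows "nikodym_set R d (vecs R d)"
proof -
  interpret field R by fact
  let ?v = "\<lambda>i\<in>{..<d}. \<one>\<^bsub>R\<^esub>"
  have v: "?v \<in> vecs R d" by (auto simp: vecs_def)
  have "?v 0 \<noteq> zero_vec R d 0" using assms(2) by (simp add: zero_vec_def)
  then have nz: "?v \<noteq> zero_vec R d" by metis
  have "punctured_line R d x ?v \<subseteq> vecs R d" if "x \<in> vecs R d" for x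
    using that by (fastforce simp: punctured_line_def line_point_def vecs_def)
  with v nz show ?thesis unfolding nikodym_set_def by blast
qed

lemma nikodym_number_attained:
  assumes "field R" and "0 < d"
  obtains N where "nikodym_set R d N" and "card N = nikodym_number R d"
  using LeastI_ex[of "\<lambda>n. \<exists>N. nikodym_set R d N \<and> card N = n"] nikodym_set_vecs[OF assms]
  unfolding nikodym_number_def by metis

text \<open>For prime \<open>q\<close> the field with \<open>q\<close> elements is \<open>residue_ring (int q)\<close>.\<close>

definition Nikodym :: "nat \<Rightarrow> nat \<Rightarrow> nat" where
  "Nikodym d q = nikodym_number (residue_ring (int q)) d"

end

theory Submission
  imports Defs
begin

text \<open>
  We look for a large complement \<open>E\<close> consisting of points \<open>(x, a + x\<^sup>2)\<close> with \<open>0 \<le> x < M\<close>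
  and \<open>a \<in> A\<close>, where \<open>M\<^sup>2\<close> is a small fraction of \<open>q\<close>. Through \<open>(x, c + x\<^sup>2)\<close> take the line of
  slope \<open>2x + r\<close>: at abscissa \<open>x + u\<close> it meets \<open>E\<close> only if \<open>c + ru - u\<^sup>2 \<in> A\<close>, and if \<open>r\<close> is at
  most \<open>M\<close> this is an equality of integers. For \<open>r = 0\<close> and \<open>c \<in> A\<close> the line is good as soon as
  \<open>A\<close> has no two elements differing by a nonzero square, so Ruzsa's construction applies: in base
  17 the digits of \<open>a\<close> in even positions are restricted to \<open>{0, 3}\<close>, 3 being a non-residue, and
  the others are free; \<open>A\<close> then has at least \<open>M\<^bsup>1 + \<delta>\<^esup>\<close> elements for some \<open>\<delta> > 0\<close>. If \<open>c \<notin> A\<close>, its first bad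
  digit in an even position can be kept bad for every \<open>u\<close> by choosing \<open>r\<close>, thanks to a property of
  the pair \<open>{0, 3}\<close> modulo 17 that no pair has modulo 5 or 13.
\<close>

section \<open>Digit restrictions in base 17\<close>

fun admissible :: "nat \<Rightarrow> int \<Rightarrow> bool" where
  "admissible 0 a \<longleftrightarrow> True"
| "admissible (Suc k) a \<longleftrightarrow> a mod 17 \<in> {0, 3} \<and> admissible k (a div 289)"

text \<open>Two digits from {0, 3} differ by 0, 3 or -3. Since -1 is a square modulo 17, both 3 and
  -3 are non-residues.\<close>

lemma square_mod_17:
  fixes c u :: int
  assumes "c mod 17 \<in> {0, 3}" and "\<not> 17 dvd u"
  shows "(c - u\<^sup>2) mod 17 \<notin> {0, 3}"
proof -
  have *: "\<forall>u\<in>set [1..16]. \<forall>c\<in>{0, 3::int}. (c - u\<^sup>2) mod 17 \<notin> {0, 3}"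
    by code_simp
  have "u mod 17 \<in> set [1..16]"
    using assms(2) pos_mod_bound[of 17 u] pos_mod_sign[of 17 u]
    by (auto simp: dvd_eq_mod_eq_0 simp del: pos_mod_sign)
  from bspec[OF bspec[OF * this] assms(1)]
  have "(c mod 17 - (u mod 17)\<^sup>2) mod 17 \<notin> {0, 3}" .
  moreover have "(c mod 17 - (u mod 17)\<^sup>2) mod 17 = (c - u\<^sup>2) mod 17"
    unfolding cong_def[symmetric]
    by (intro cong_diff cong_pow) (auto simp: cong_def)
  ultimately show ?thesis by simp
qed

text \<open>After completing the square the values are e - s^2 with e = c + (r/2)^2, so e and e - 3
  must both be non-residues, that is, e is 6, 10 or 14. Subtracting squares from these three yields
  exactly the residues other than 0 and 3.\<close>

lemma quadratic_mod_17:
  fixes c :: int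
  assumes "c mod 17 \<notin> {0, 3}"
  obtains r where "0 \<le> r" "r < 17" "\<And>u. (c + r * u - u\<^sup>2) mod 17 \<notin> {0, 3}"
proof -
  have *: "\<forall>c\<in>set [0..16]. c \<notin> {0, 3::int} \<longrightarrow>
      (\<exists>r\<in>set [0..16]. \<forall>u\<in>set [0..16]. (c + r * u - u\<^sup>2) mod 17 \<notin> {0, 3})"
    by code_simp
  have mem: "u mod 17 \<in> set [0..16]" for u :: int
    using pos_mod_bound[of 17 u] by simp
  from * mem assms obtain r where r: "r \<in> set [0..16]"
    and ru: "\<And>u. u \<in> set [0..16] \<Longrightarrow> (c mod 17 + r * u - u\<^sup>2) mod 17 \<notin> {0, 3}"
    by meson
  have "(c + r * u - u\<^sup>2) mod 17 \<notin> {0, 3}" for u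
  proof -
    have "(c mod 17 + r * (u mod 17) - (u mod 17)\<^sup>2) mod 17 = (c + r * u - u\<^sup>2) mod 17"
      unfolding cong_def[symmetric]
      by (intro cong_diff cong_add cong_mult cong_pow) (auto simp: cong_def)
    then show ?thesis using ru[OF mem[of u]] by simp
  qed
  with r show thesis by (intro that[of r]) auto
qed

text \<open>If the lowest digit of \<open>c\<close> is bad, some slope below 17 keeps it bad for all
  \<open>u\<close>. Otherwise 17 times the slope found for \<open>c div 289\<close> works: a
  \<open>u\<close> prime to 17 spoils the lowest digit, and a multiple of 17 reduces to the
  induction hypothesis.\<close>

lemma avoiding_slope:
  fixes c :: int
  shows "\<exists>r. 0 \<le> r \<and> r \<le> 17 ^ k \<and>
    (\<forall>u. u \<noteq> 0 \<and> \<bar>u\<bar> < 17 ^ k \<longrightarrow> \<not> admissible k (c + r * u - u\<^sup>2))"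
proof (induction k arbitrary: c)
  case 0
  show ?case by (intro exI[of _ 0]) auto
next
  case (Suc k)
  show ?case
  proof (cases "c mod 17 \<in> {0, 3}")
    case False
    then obtain r where "0 \<le> r" "r < 17" "\<And>u. (c + r * u - u\<^sup>2) mod 17 \<notin> {0, 3}"
      using quadratic_mod_17 by blast
    moreover have "(17::int) \<le> 17 ^ Suc k" by simp
    ultimately show ?thesis
      by (intro exI[of _ r]) (auto simp del: power_Suc)
  next
    case True
    obtain r where r: "0 \<le> r" "r \<le> 17 ^ k"
      and ru: "\<And>u. u \<noteq> 0 \<Longrightarrow> \<bar>u\<bar> < 17 ^ k \<Longrightarrow> \<not> admissible k (c div 289 + r * u - u\<^sup>2)"
      using Suc.IH[of "c div 289"] by blast
    have "\<not> admissible (Suc k) (c + 17 * r * u - u\<^sup>2)"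
      if u: "u \<noteq> 0" "\<bar>u\<bar> < 17 ^ Suc k" for u
    proof (cases "17 dvd u")
      case False
      have "(c + 17 * r * u) mod 17 = c mod 17"
        by (simp add: mult.assoc)
      with square_mod_17[of "c + 17 * r * u" u] True False show ?thesis
        by simp
    next
      case True
      then obtain w where w: "u = 17 * w" ..
      \<comment> \<open>Slope and displacement are both multiples of 17, so the change is a multiple
        of 289 and the lowest digit pair of \<open>c\<close> is dropped intact.\<close>
      have "c + 17 * r * u - u\<^sup>2 = c + (r * w - w\<^sup>2) * 289"
        by (simp add: w power2_eq_square algebra_simps)
      then have "(c + 17 * r * u - u\<^sup>2) div 289 = c div 289 + r * w - w\<^sup>2"
        by simp
      moreover have "w \<noteq> 0" "\<bar>w\<bar> < 17 ^ k"
        using u w by (auto simp: abs_mult)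
      ultimately show ?thesis using ru by simp
    qed
    then show ?thesis using r by (intro exI[of _ "17 * r"]) auto
  qed
qed

section \<open>Counting admissible integers\<close>

lemma card_digit_extension:
  fixes D A :: "int set"
  assumes "D \<subseteq> {0..<n}"
  shows "card ((\<lambda>(d, a). d + n * a) ` (D \<times> A)) = card D * card A"
proof -
  have digit: "d mod n = d" "(d + n * a) div n = a" if "d \<in> D" for d a
    using that assms by auto
  have "inj_on (\<lambda>(d, a). d + n * a) (D \<times> A)"
    by (rule inj_on_inverseI[of _ "\<lambda>b. (b mod n, b div n)"]) (auto simp: digit)
  then show ?thesis by (simp add: card_image card_cartesian_product)
qed

text \<open>Each base-289 digit has 2 * 17 = 34 allowed values. This is twice the square root of
  289, and the resulting factor 2^k is the source of the power saving.\<close>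

lemma card_admissible:
  "34 ^ k \<le> card {a \<in> {0..<289 ^ k}. admissible k a}"
proof (induction k)
  case 0
  have "{a \<in> {0..<289 ^ 0}. admissible 0 a} = {0}" by auto
  then show ?case by simp
next
  case (Suc k)
  let ?G = "\<lambda>k. {a \<in> {0..<289 ^ k}. admissible k a}"
  define D where "D = (\<lambda>(r, j). r + 17 * j) ` ({0, 3} \<times> {0..<17::int})"
  have card_D: "card D = 34"
    unfolding D_def by (subst card_digit_extension) auto
  have D: "0 \<le> d \<and> d < 289 \<and> d mod 17 \<in> {0, 3}" if "d \<in> D" for d
    using that by (auto simp: D_def)
  let ?H = "(\<lambda>(d, a). d + 289 * a) ` (D \<times> ?G k)"
  have card_H: "card ?H = 34 * card (?G k)"
    using D by (subst card_digit_extension) (auto simp: card_D)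
  have "d + 289 * a \<in> ?G (Suc k)" if d: "d \<in> D" and a: "a \<in> ?G k" for d a
  proof -
    have "(d + 289 * a) mod 17 = d mod 17"
      using mod_mult_self2[of d 17 "17 * a"] by simp
    moreover have "(d + 289 * a) div 289 = a"
      using D[OF d] by simp
    moreover have "0 \<le> d + 289 * a" "d + 289 * a < 289 ^ Suc k"
      using D[OF d] a by auto
    ultimately show ?thesis
      using D[OF d] a by simp
  qed
  then have "?H \<subseteq> ?G (Suc k)" by auto
  moreover have "finite (?G (Suc k))"
    by (rule finite_subset[of _ "{0..<289 ^ Suc k}"]) auto
  ultimately have "card ?H \<le> card (?G (Suc k))"
    by (rule card_mono[rotated])
  with card_H Suc.IH show ?case by simp
qed

section \<open>Coordinates in the plane over the residue ring\<close>

definition point :: "int \<Rightarrow> int \<Rightarrow> nat \<Rightarrow> int" where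
  "point x y = (\<lambda>i\<in>{..<2}. if i = 0 then x else y)"

lemma point_simps [simp]: "point x y 0 = x" "point x y (Suc 0) = y"
  by (auto simp: point_def)

lemma point_eq_iff: "point x y = point x' y' \<longleftrightarrow> x = x' \<and> y = y'"
  by (auto dest: fun_cong[of _ _ 0] fun_cong[of _ _ "Suc 0"])

lemma vecs_2_point:
  assumes "P \<in> vecs R 2"
  shows "P = point (P 0) (P 1)"
proof
  fix i
  show "P i = point (P 0) (P 1) i"
  proof (cases "i < 2")
    case True
    then have "i = 0 \<or> i = 1" by linarith
    then show ?thesis by (elim disjE) simp_all
  next
    case False
    then show ?thesis
      using assms PiE_arb[of P "{..<2}" "\<lambda>_. carrier R" i] by (simp add: vecs_def point_def)
  qed
qed

lemma point_in_vecs: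
  "x \<in> carrier R \<Longrightarrow> y \<in> carrier R \<Longrightarrow> point x y \<in> vecs R 2"
  by (auto simp: vecs_def point_def)

lemma line_point_residue_ring:
  "line_point (residue_ring q) 2 (point x y) (point v w) t =
    point ((x + t * v) mod q) ((y + t * w) mod q)"
  by (auto simp: line_point_def point_def residue_ring_def mod_add_right_eq fun_eq_iff)

lemma zero_vec_residue_ring: "zero_vec (residue_ring q) 2 = point 0 0"
  by (auto simp: zero_vec_def point_def residue_ring_def fun_eq_iff)

text \<open>A representative bounded by \<open>q / 2\<close> instead of \<open>q\<close> leaves room
  for further terms when a congruence is turned into an equality of integers.\<close>

lemma centered_residue:
  fixes b q :: int
  assumes "0 < q"
  obtains c where "2 * \<bar>c\<bar> \<le> q" "q dvd c - b"
proof (cases "2 * (b mod q) \<le> q")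
  case True
  then show thesis
    using assms by (intro that[of "b mod q"]) (auto simp: mod_eq_dvd_iff[symmetric])
next
  case False
  then show thesis
    using pos_mod_bound[OF assms, of b]
    by (intro that[of "b mod q - q"]) (simp, simp add: mod_eq_dvd_iff[symmetric])
qed

section \<open>The removed points and their good lines\<close>

definition parabola_points :: "nat \<Rightarrow> int \<Rightarrow> (nat \<Rightarrow> int) set" where
  "parabola_points k q = (\<lambda>(x, a). point x ((a + x\<^sup>2) mod q)) `
     ({0..<17 ^ k} \<times> {a \<in> {0..<289 ^ k}. admissible k a})"

lemma power_289: "(289::int) ^ k = 17 ^ k * 17 ^ k"
  by (simp flip: power_mult_distrib)

lemma parabola_points_subset:
  assumes "6 * 289 ^ k \<le> q"
  shows "parabola_points k q \<subseteq> vecs (residue_ring q) 2"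
proof -
  have "(17::int) ^ k \<le> 289 ^ k" by (intro power_mono) auto
  moreover have "(0::int) < 289 ^ k" by simp
  ultimately have "17 ^ k \<le> q" "0 < q" using assms by linarith+
  then show ?thesis
    unfolding parabola_points_def
    by (force intro!: point_in_vecs simp: residue_ring_def)
qed

text \<open>The first coordinate gives \<open>x\<close>, the second then gives \<open>a\<close>
  modulo \<open>q\<close>, and \<open>a\<close> lies in an interval shorter than
  \<open>q\<close>.\<close>

lemma card_parabola_points:
  assumes "6 * 289 ^ k \<le> q"
  shows "578 ^ k \<le> card (parabola_points k q)"
proof -
  let ?G = "{a \<in> {0..<289 ^ k}. admissible k a}"
  have "inj_on (\<lambda>(x, a). point x ((a + x\<^sup>2) mod q)) ({0..<17 ^ k} \<times> ?G)"
  proof (rule inj_onI, clarify)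
    fix x a x' a' :: int
    assume a: "a \<in> {0..<289 ^ k}" "a' \<in> {0..<289 ^ k}"
      and eq: "point x ((a + x\<^sup>2) mod q) = point x' ((a' + x'\<^sup>2) mod q)"
    have "x = x'" using eq by (simp add: point_eq_iff)
    moreover have "a = a'"
    proof -
      have "q dvd a - a'"
        using eq by (auto simp: point_eq_iff mod_eq_dvd_iff)
      moreover have "\<bar>a - a'\<bar> < q"
        using a assms by auto
      ultimately show ?thesis using dvd_imp_le_int[of "a - a'" q] by fastforce
    qed
    ultimately show "x = x' \<and> a = a'" ..
  qed
  then have "card (parabola_points k q) = 17 ^ k * card ?G"
    unfolding parabola_points_def
    by (simp add: card_image card_cartesian_product nat_power_eq)
  moreover have "(578::nat) ^ k = 17 ^ k * 34 ^ k"
    by (simp flip: power_mult_distrib)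
  ultimately show ?thesis using card_admissible[of k] by simp
qed

lemma nikodym_complement_parabola_points:
  assumes q: "6 * 289 ^ k \<le> q"
  shows "nikodym_set (residue_ring q) 2 (vecs (residue_ring q) 2 - parabola_points k q)"
  unfolding nikodym_set_def
proof (intro conjI ballI)
  let ?R = "residue_ring q" and ?M = "17 ^ k :: int"
  let ?E = "parabola_points k q"
  have M: "0 < ?M" "?M \<le> 289 ^ k" by (auto intro: power_mono)
  then have "1 < q" "0 < q" using q by linarith+
  then have carrier: "carrier ?R = {0..<q}" by (auto simp: residue_ring_def)
  show "vecs ?R 2 - ?E \<subseteq> vecs ?R 2" by blast
  fix P assume P: "P \<in> vecs ?R 2"
  define x y where "x = P 0" and "y = P 1"
  have P_eq: "P = point x y" using vecs_2_point[OF P] by (simp add: x_def y_def)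
  have xy: "0 \<le> x" "x < q" "0 \<le> y" "y < q"
    using P carrier by (auto simp: x_def y_def vecs_def PiE_def Pi_def)
  \<comment> \<open>It suffices to find a nonzero direction whose line meets \<open>?E\<close> at
    most in \<open>P\<close>.\<close>
  have *: "\<exists>v\<in>vecs ?R 2 - {zero_vec ?R 2}. punctured_line ?R 2 P v \<subseteq> vecs ?R 2 - ?E"
    if v: "0 \<le> v" "v < q" and w: "0 \<le> w" "w < q" and nz: "v \<noteq> 0 \<or> w \<noteq> 0"
      and tangent: "\<And>t. point ((x + t * v) mod q) ((y + t * w) mod q) \<in> ?E \<Longrightarrow>
          (x + t * v) mod q = x \<and> (y + t * w) mod q = y" for v w
  proof (intro bexI[of _ "point v w"])
    show "point v w \<in> vecs ?R 2 - {zero_vec ?R 2}"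
    proof
      show "point v w \<in> vecs ?R 2"
        using v w by (intro point_in_vecs) (simp_all add: carrier)
      show "point v w \<notin> {zero_vec ?R 2}"
        using nz by (simp add: zero_vec_residue_ring point_eq_iff)
    qed
    show "punctured_line ?R 2 P (point v w) \<subseteq> vecs ?R 2 - ?E"
    proof
      fix L assume "L \<in> punctured_line ?R 2 P (point v w)"
      then obtain t where L: "L = point ((x + t * v) mod q) ((y + t * w) mod q)" and "L \<noteq> P"
        by (auto simp: punctured_line_def P_eq line_point_residue_ring)
      then have "L \<notin> ?E" using tangent[of t] by (auto simp: P_eq)
      moreover have "L \<in> vecs ?R 2"
        unfolding L using \<open>1 < q\<close> by (intro point_in_vecs) (auto simp: carrier)
      ultimately show "L \<in> vecs ?R 2 - ?E" by blast
    qed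
  qed
  show "\<exists>v\<in>vecs ?R 2 - {zero_vec ?R 2}. punctured_line ?R 2 P v \<subseteq> vecs ?R 2 - ?E"
  proof (cases "x < ?M")
    case False
    \<comment> \<open>All abscissas in \<open>?E\<close> are below \<open>?M\<close>, so the
      vertical line misses \<open>?E\<close>.\<close>
    show ?thesis
    proof (rule *[of 0 1])
      fix t assume "point ((x + t * 0) mod q) ((y + t * 1) mod q) \<in> ?E"
      then show "(x + t * 0) mod q = x \<and> (y + t * 1) mod q = y"
        using False xy by (auto simp: parabola_points_def point_eq_iff)
    qed (use \<open>1 < q\<close> in auto)
  next
    case True
    obtain c where c: "2 * \<bar>c\<bar> \<le> q" "q dvd c - (y - x\<^sup>2)"
      using centered_residue[of q "y - x\<^sup>2"] \<open>0 < q\<close> by blast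
    obtain r where r: "0 \<le> r" "r \<le> ?M"
      and avoid: "\<And>u. u \<noteq> 0 \<Longrightarrow> \<bar>u\<bar> < ?M \<Longrightarrow> \<not> admissible k (c + r * u - u\<^sup>2)"
      using avoiding_slope[of k c] by blast
    \<comment> \<open>The slope rests on \<open>c + x\<^sup>2 + (r + 2 * x) * u = (c + r * u -
      u\<^sup>2) + (x + u)\<^sup>2\<close>.\<close>
    define w where "w = (r + 2 * x) mod q"
    show ?thesis
    proof (rule *[of 1 w])
      fix t assume "point ((x + t * 1) mod q) ((y + t * w) mod q) \<in> ?E"
      then obtain z a where z: "0 \<le> z" "z < ?M" and a: "0 \<le> a" "a < 289 ^ k" "admissible k a"
        and z_eq: "(x + t) mod q = z" and a_eq: "(y + t * w) mod q = (a + z\<^sup>2) mod q"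
        by (auto simp: parabola_points_def point_eq_iff)
      \<comment> \<open>The parameter \<open>t\<close> matters only modulo \<open>q\<close>; its
        representative \<open>u\<close> is a difference of two abscissas in [0, \<open>?M\<close>),
        hence small.\<close>
      define u where "u = z - x"
      have u: "\<bar>u\<bar> < ?M" using z True xy by (auto simp: u_def)
      have "q dvd t - u"
        using dvd_minus_mod[of q "x + t"] unfolding z_eq by (simp add: u_def algebra_simps)
      then obtain i where "t - u = q * i" ..
      then have i: "t = u + q * i" by simp
      have "q dvd w - (r + 2 * x)"
        by (simp add: w_def flip: mod_eq_dvd_iff)
      then obtain j where "w - (r + 2 * x) = q * j" ..
      then have j: "w = r + 2 * x + q * j" by simp
      obtain l where "c - (y - x\<^sup>2) = q * l" using c(2) ..
      then have l: "y = c + x\<^sup>2 - q * l" by simp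
      obtain n where n: "y + t * w - (a + z\<^sup>2) = q * n"
        using a_eq by (metis mod_eq_dvd_iff dvdE)
      have "c + r * u - u\<^sup>2 - a = q * (n + l - u * j - i * w)"
        using n unfolding l i j u_def by (simp add: power2_eq_square algebra_simps)
      then have dvd: "q dvd c + r * u - u\<^sup>2 - a" by simp
      have "\<bar>r * u\<bar> \<le> ?M * ?M"
        unfolding abs_mult using r u by (intro mult_mono) auto
      moreover have "\<bar>u\<bar> * \<bar>u\<bar> \<le> ?M * ?M"
        using u by (intro mult_mono) auto
      then have "u\<^sup>2 \<le> ?M * ?M"
        by (simp add: power2_eq_square)
      \<comment> \<open>Here the constant 6 enters: \<open>c\<close> is at most q/2 in size, and
        \<open>r * u\<close>, \<open>u\<^sup>2\<close> and \<open>a\<close> are at most q/6 each,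
        \<open>a\<close> strictly.\<close>
      ultimately have "\<bar>c + r * u - u\<^sup>2 - a\<bar> < q"
        using c(1) a(1,2) q zero_le_power2[of u] unfolding power_289 by linarith
      with dvd have "c + r * u - u\<^sup>2 = a"
        using dvd_imp_le_int[of "c + r * u - u\<^sup>2 - a" q] by fastforce
      with avoid a u have "u = 0" by blast
      then show "(x + t * 1) mod q = x \<and> (y + t * w) mod q = y"
        using i xy by (simp add: mult.assoc)
    qed (use \<open>1 < q\<close> in \<open>auto simp: w_def\<close>)
  qed
qed

section \<open>From the count to the exponent\<close>

lemma card_vecs_residue_ring:
  "card (vecs (residue_ring (int q)) d) = q ^ d"
  by (simp add: vecs_def card_PiE residue_ring_def)

lemma Nikodym_le_parabola:
  assumes "6 * 289 ^ k \<le> q"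
  shows "Nikodym 2 q + 578 ^ k \<le> q\<^sup>2"
proof -
  let ?V = "vecs (residue_ring (int q)) 2" and ?E = "parabola_points k (int q)"
  have q: "6 * 289 ^ k \<le> int q"
    using assms by (metis of_nat_le_iff of_nat_mult of_nat_numeral of_nat_power)
  have fin: "finite ?V" by (intro finite_vecs) (simp add: residue_ring_def)
  have "Nikodym 2 q \<le> card (?V - ?E)"
    unfolding Nikodym_def nikodym_number_def
    using nikodym_complement_parabola_points[OF q] by (intro Least_le) blast
  moreover have "card (?V - ?E) = q\<^sup>2 - card ?E" "card ?E \<le> q\<^sup>2"
    using parabola_points_subset[OF q] fin
    by (auto simp: card_Diff_subset finite_subset card_mono simp flip: card_vecs_residue_ring)
  ultimately show ?thesis using card_parabola_points[OF q] by linarith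
qed

text \<open>Since 578 = 2 * 289 and 289 < 2^9, the gain 2^k is roughly at least p^(1/9). Halving
  that exponent absorbs the constants.\<close>

lemma powr_le_power_578:
  fixes p :: real
  assumes "24 \<le> k" "0 < p" "p \<le> 2 ^ 11 * 289 ^ k"
  shows "p powr (1 + 1 / 18) \<le> 578 ^ k"
proof -
  have "(289::real) ^ k \<le> (2 ^ 9) ^ k" by (intro power_mono) auto
  then have "p \<le> 2 ^ (11 + 9 * k)"
    using assms(3) by (simp add: power_add power_mult)
  then have "p powr (1 / 18) \<le> (2 ^ (11 + 9 * k)) powr (1 / 18)"
    using assms(2) by (intro powr_mono2) auto
  also have "\<dots> = 2 powr ((11 + 9 * real k) / 18)"
    by (simp add: powr_powr flip: powr_realpow)
  \<comment> \<open>This amounts to 209 \<le> 9k, hence the threshold 24.\<close>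
  also have "\<dots> \<le> 2 powr (real k - 11)"
    using assms(1) by (intro powr_mono) auto
  also have "\<dots> = 2 ^ k / 2 ^ 11"
    by (simp add: powr_diff powr_realpow)
  finally have "p * p powr (1 / 18) \<le> (2 ^ 11 * 289 ^ k) * (2 ^ k / 2 ^ 11)"
    using assms by (intro mult_mono) auto
  also have "\<dots> = 578 ^ k"
    by (simp flip: power_mult_distrib)
  finally show ?thesis using assms(2) by (simp only: powr_add) simp
qed

theorem theorem1p11:
  "\<exists>c::real. c > 0 \<and> (\<exists>q0::nat. \<forall>q::nat. prime q \<and> q \<ge> q0 \<longrightarrow>
      real (Nikodym 2 q) \<le> real q ^ 2 - real q powr (1 + c))"
proof (intro exI[of _ "1 / 18"] conjI exI[of _ "6 * 289 ^ 24"] allI impI)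
  fix q :: nat
  assume "prime q \<and> 6 * 289 ^ 24 \<le> q"
  then have q: "289 ^ 24 \<le> q div 6" by linarith
  then have "1 \<le> q div 6" by simp
  \<comment> \<open>The largest \<open>k\<close> with 6 * 289^k \<le> q; then q < 1734 * 289^k, and
    1734 < 2^11.\<close>
  then obtain k where k: "289 ^ k \<le> q div 6" "q div 6 < 289 ^ (k + 1)"
    using ex_power_ivl1[of 289 "q div 6"] by auto
  have "(289::nat) ^ 24 < 289 ^ (k + 1)" using q k(2) by linarith
  then have "24 \<le> k" by (subst (asm) power_strict_increasing_iff) auto
  have le: "6 * 289 ^ k \<le> q" using k(1) by linarith
  have "q < 6 * 289 ^ (k + 1)" using k(2) by linarith
  then have "q \<le> 2 ^ 11 * 289 ^ k" by simp
  then have "real q \<le> real (2 ^ 11 * 289 ^ k)"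
    by (simp only: of_nat_le_iff)
  then have "real q \<le> 2 ^ 11 * 289 ^ k" by simp
  moreover have "0 < q" using \<open>1 \<le> q div 6\<close> by (cases q) auto
  ultimately have "real q powr (1 + 1 / 18) \<le> 578 ^ k"
    using powr_le_power_578[OF \<open>24 \<le> k\<close>, of "real q"] by simp
  moreover have "real (Nikodym 2 q + 578 ^ k) \<le> real (q\<^sup>2)"
    using Nikodym_le_parabola[OF le] by (simp only: of_nat_le_iff)
  ultimately show "real (Nikodym 2 q) \<le> real q ^ 2 - real q powr (1 + 1 / 18)"
    by simp
qed simp

end
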